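(* Let $p>2$ be a prime, $n\ge13$ an integer, and let $M_1,\dots,M_n$ be symmetric $n\times n$ matrices over $\mathbb{F}_p$ such that every nonzero $\mathbb{F}_p$-linear combination of them has rank $n$. Let $Q_i(x)=x^TM_ix$ and $\mathrm{QGS}(p,n)=\{x\in\mathbb{F}_p^n : \exists i \text{ with } Q_1(x)=\dots=Q_{i-1}(x)=0,\ Q_i(x)=1\}$. Then the $\mathrm{VC}_2$-dimension of $\mathrm{QGS}(p,n)$ is at least $2$.
   Context: For a finite abelian group $G$ and $A\subseteq G$, $A$ has $\mathrm{VC}_2$-dimension at least $k$ ($k\ge1$) if there exist elements $\{x_i: i\in[k]\}\cup\{y_i : i\in[k]\}\cup\{z_S : S\subseteq[k]^2\}$ of $G$ such that $x_i+y_j+z_S\in A$ if and only if $(i,j)\in S$; the $\mathrm{VC}_2$-dimension of $A$ is the largest such $k$. *)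

theory Defs
  imports "HOL-Analysis.Analysis" "Berlekamp_Zassenhaus.Finite_Field"
begin

definition vc2_dim_at_least :: "'g::{finite, ab_group_add} set \<Rightarrow> nat \<Rightarrow> bool" where
  "vc2_dim_at_least A k \<longleftrightarrow>
     (\<exists>(x :: nat \<Rightarrow> 'g) (y :: nat \<Rightarrow> 'g) (z :: (nat \<times> nat) set \<Rightarrow> 'g).
        \<forall>S \<subseteq> {1..k} \<times> {1..k}. \<forall>i \<in> {1..k}. \<forall>j \<in> {1..k}.
          x i + y j + z S \<in> A \<longleftrightarrow> (i, j) \<in> S)"

text \<open>The element 0 only fixes the value for sets that are not of dimension at least 1.
  The maximum is over a finite set, see \<open>le_vc2_dim_iff\<close> below.\<close>

definition vc2_dim :: "'g::{finite, ab_group_add} set \<Rightarrow> nat" where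
  "vc2_dim A = Max (insert 0 {k. 1 \<le> k \<and> vc2_dim_at_least A k})"

lemma vc2_dim_at_least_mono:
  assumes "vc2_dim_at_least A k" "l \<le> k"
  shows "vc2_dim_at_least A l"
proof -
  from assms(1) obtain x y z where *:
    "\<And>S i j. S \<subseteq> {1..k} \<times> {1..k} \<Longrightarrow> i \<in> {1..k} \<Longrightarrow> j \<in> {1..k} \<Longrightarrow>
       x i + y j + z S \<in> A \<longleftrightarrow> (i, j) \<in> S"
    unfolding vc2_dim_at_least_def by metis
  have sub: "{1..l} \<subseteq> {1..k}" using assms(2) by auto
  show ?thesis
    unfolding vc2_dim_at_least_def
  proof (intro exI allI ballI impI)
    fix S i j assume "S \<subseteq> {1..l} \<times> {1..l}" "i \<in> {1..l}" "j \<in> {1..l}"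
    with sub show "x i + y j + z S \<in> A \<longleftrightarrow> (i, j) \<in> S"
      by (intro *) blast+
  qed
qed

lemma vc2_dim_at_least_bound:
  fixes A :: "'g::{finite, ab_group_add} set"
  assumes "vc2_dim_at_least A k"
  shows "k \<le> CARD('g)"
proof -
  from assms obtain x y z where *:
    "\<And>S i j. S \<subseteq> {1..k} \<times> {1..k} \<Longrightarrow> i \<in> {1..k} \<Longrightarrow> j \<in> {1..k} \<Longrightarrow>
       x i + y j + z S \<in> A \<longleftrightarrow> (i, j) \<in> S"
    unfolding vc2_dim_at_least_def by metis
  have inj: "inj_on (\<lambda>i. z {(i, i)}) {1..k}"
  proof (rule inj_onI)
    fix i j assume ij: "i \<in> {1..k}" "j \<in> {1..k}" "z {(i, i)} = z {(j, j)}"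
    have "x i + y i + z {(i, i)} \<in> A" using *[of "{(i, i)}" i i] ij by auto
    then show "i = j" using *[of "{(j, j)}" i i] ij by auto
  qed
  have "card {1..k} \<le> card (UNIV :: 'g set)"
    by (rule card_inj_on_le[OF inj]) auto
  then show ?thesis by simp
qed

lemma le_vc2_dim_iff:
  fixes A :: "'g::{finite, ab_group_add} set"
  assumes "1 \<le> k"
  shows "k \<le> vc2_dim A \<longleftrightarrow> vc2_dim_at_least A k"
proof -
  have fin: "finite (insert 0 {k. 1 \<le> k \<and> vc2_dim_at_least A k})"
    by (rule finite_subset[of _ "{..CARD('g)}"]) (auto dest: vc2_dim_at_least_bound)
  show ?thesis
    unfolding vc2_dim_def using assms vc2_dim_at_least_mono[of A _ k] fin
    by (subst Max_ge_iff) auto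
qed

definition quad_form :: "'a::field ^ 'n ^ 'n \<Rightarrow> 'a ^ 'n \<Rightarrow> 'a" where
  "quad_form M x = scalar_product x (M *v x)"

text \<open>The sequence of matrices is indexed by \<open>1, \<dots>, CARD('n)\<close>; other values of \<open>M\<close> are irrelevant.\<close>

definition QGS :: "(nat \<Rightarrow> 'a::field ^ 'n ^ 'n) \<Rightarrow> ('a ^ 'n) set" where
  "QGS M = {x. \<exists>i \<in> {1..CARD('n)}.
     (\<forall>j \<in> {1..<i}. quad_form (M j) x = 0) \<and> quad_form (M i) x = 1}"

definition mat_lincomb :: "(nat \<Rightarrow> 'a::field) \<Rightarrow> (nat \<Rightarrow> 'a ^ 'n ^ 'n) \<Rightarrow> 'a ^ 'n ^ 'n" where
  "mat_lincomb c M = (\<chi> r s. \<Sum>i = 1..CARD('n). c i * M i $ r $ s)"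

end

(*
  Write Q(x, y) for the pair of values of the bilinear forms of M 1 and M 2. The first two forms
  already suffice: fix a and b with Q(a, b) zero in the first coordinate, and look at the
  parallelogram z, z + a, z + b, z + a + b. The values of Q(x, x) at its first three vertices are
  determined by Q(z, z), Q(z, a), Q(z, b), and the value at the last vertex then follows from the
  parallelogram identity. If M_\<mu> a + M_\<nu> b is nonzero for all (\<mu>, \<nu>) \<noteq> 0, these six values can be
  prescribed arbitrarily: in the expansion of the number of solutions z into additive characters,
  the terms involving Q(z, z) are Gauss sums of nondegenerate forms, of size p^(n/2), and there are
  fewer than p^6 of them, so for n \<ge> 12 the main term p^n wins. A suitable b exists by counting,
  and each of the 16 membership patterns is realised by explicit values.
*)

theory Submission
  imports Defs
begin

notation scalar_product (infixl "\<cdot>" 70)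

section \<open>Scalar products and pencils of matrices\<close>

lemma scalar_product_add_left: "(x + y) \<cdot> z = x \<cdot> z + y \<cdot> z"
  by (simp add: scalar_product_def distrib_right sum.distrib)

lemma scalar_product_add_right: "x \<cdot> (y + z) = x \<cdot> y + x \<cdot> z"
  by (simp add: scalar_product_def distrib_left sum.distrib)

lemma scalar_product_diff_right: "x \<cdot> (y - z) = x \<cdot> y - x \<cdot> (z :: 'a::ring_1 ^ 'n)"
  by (simp add: scalar_product_def right_diff_distrib sum_subtractf)

lemma scalar_product_commute: "x \<cdot> y = y \<cdot> (x :: 'a::comm_ring_1 ^ 'n)"
  by (simp add: scalar_product_def mult.commute)

lemma scalar_product_zero [simp]: "0 \<cdot> x = 0" "x \<cdot> 0 = 0"
  by (simp_all add: scalar_product_def)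

lemma scalar_product_axis: "x \<cdot> axis i c = x $ i * c"
proof -
  have "x $ j * axis i c $ j = (if j = i then x $ i * c else 0)" for j
    by (simp add: axis_def)
  then show ?thesis
    by (simp add: scalar_product_def)
qed

lemma scalar_product_symmetric_matrix:
  fixes A :: "'a::comm_ring_1 ^ 'n ^ 'n"
  assumes "transpose A = A"
  shows "x \<cdot> (A *v y) = y \<cdot> (A *v x)"
proof -
  have A: "A $ j $ i = A $ i $ j" for i j
    using arg_cong [OF assms, of "\<lambda>B. B $ i $ j"] by (simp add: transpose_def)
  have "x \<cdot> (A *v y) = (\<Sum>i\<in>UNIV. \<Sum>j\<in>UNIV. x $ i * (A $ i $ j * y $ j))"
    by (simp add: scalar_product_def matrix_vector_mult_def sum_distrib_left)
  also have "\<dots> = (\<Sum>j\<in>UNIV. \<Sum>i\<in>UNIV. y $ j * (A $ j $ i * x $ i))"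
    by (subst sum.swap, intro sum.cong refl, subst A, simp only: mult_ac)
  also have "\<dots> = y \<cdot> (A *v x)"
    by (simp add: scalar_product_def matrix_vector_mult_def sum_distrib_left)
  finally show ?thesis .
qed

section \<open>Linear combinations of forms and the vector of their values\<close>

definition pencil :: "('k::finite \<Rightarrow> 'a::comm_ring_1 ^ 'n ^ 'n) \<Rightarrow> 'a ^ 'k \<Rightarrow> 'a ^ 'n ^ 'n" where
  "pencil M \<kappa> = (\<chi> r s. \<Sum>i\<in>UNIV. \<kappa> $ i * M i $ r $ s)"

definition bil :: "('k::finite \<Rightarrow> 'a::comm_ring_1 ^ 'n ^ 'n) \<Rightarrow> 'a ^ 'n \<Rightarrow> 'a ^ 'n \<Rightarrow> 'a ^ 'k" where
  "bil M x y = (\<chi> i. x \<cdot> (M i *v y))"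

text \<open>Exchanging finite sums moves \<kappa> inside the matrix. A character of
  \<open>bil M z z\<close> thereby becomes a character of one quadratic form, to which the Gauss sum
  estimate applies.\<close>

lemma scalar_product_pencil: "x \<cdot> (pencil M \<kappa> *v y) = \<kappa> \<cdot> bil M x y"
proof -
  have "x \<cdot> (pencil M \<kappa> *v y)
      = (\<Sum>r\<in>UNIV. \<Sum>s\<in>UNIV. \<Sum>i\<in>UNIV. x $ r * (\<kappa> $ i * M i $ r $ s * y $ s))"
    by (simp add: scalar_product_def pencil_def matrix_vector_mult_def sum_distrib_left
        sum_distrib_right)
  also have "\<dots> = (\<Sum>r\<in>UNIV. \<Sum>i\<in>UNIV. \<Sum>s\<in>UNIV. x $ r * (\<kappa> $ i * M i $ r $ s * y $ s))"
    by (rule sum.cong [OF refl], rule sum.swap)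
  also have "\<dots> = (\<Sum>i\<in>UNIV. \<Sum>r\<in>UNIV. \<Sum>s\<in>UNIV. x $ r * (\<kappa> $ i * M i $ r $ s * y $ s))"
    by (rule sum.swap)
  also have "\<dots> = (\<Sum>i\<in>UNIV. \<Sum>r\<in>UNIV. \<Sum>s\<in>UNIV. \<kappa> $ i * (x $ r * (M i $ r $ s * y $ s)))"
    by (intro sum.cong refl) (simp only: mult_ac)
  also have "\<dots> = \<kappa> \<cdot> bil M x y"
    by (simp add: scalar_product_def bil_def matrix_vector_mult_def sum_distrib_left)
  finally show ?thesis .
qed

lemma pencil_zero [simp]: "pencil M 0 = 0"
  by (simp add: pencil_def vec_eq_iff)

lemma transpose_pencil:
  assumes "\<And>i. transpose (M i) = M i"
  shows "transpose (pencil M \<kappa>) = pencil M \<kappa>"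
proof -
  have M: "M i $ s $ r = M i $ r $ s" for i r s
    using arg_cong [OF assms, of "\<lambda>B. B $ r $ s"] by (simp add: transpose_def)
  show ?thesis
    by (simp add: pencil_def transpose_def vec_eq_iff M)
qed

lemma bil_add_left: "bil M (x + y) z = bil M x z + bil M y z"
  by (simp add: bil_def vec_eq_iff scalar_product_add_left)

lemma bil_add_right: "bil M x (y + z) = bil M x y + bil M x z"
  by (simp add: bil_def vec_eq_iff scalar_product_add_right matrix_vector_right_distrib)

lemma bil_commute:
  assumes "\<And>i. transpose (M i) = M i"
  shows "bil M x y = bil M y x"
  by (simp add: bil_def vec_eq_iff scalar_product_symmetric_matrix [OF assms, of x _ y])

text \<open>\<open>rank\<close> is the dimension of the row span, so at full rank the rows span
  everything, which yields a left inverse.\<close>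

lemma full_rank_imp_inj_field:
  fixes A :: "'a::field ^ 'n ^ 'm"
  assumes "rank A = CARD('n)"
  shows "inj ((*v) A)"
proof -
  have "vec.span (rows A) = UNIV"
    using assms unfolding row_rank_def_gen
    by (subst vec.dim_eq_full [symmetric]) (simp add: vec.dimension_def card_cart_basis)
  then show ?thesis
    by (simp add: matrix_left_invertible_injective [symmetric] matrix_left_invertible_span_rows_gen)
qed

section \<open>Character sums\<close>

text \<open>The standard additive character exp(2 \<pi> i x / p) of the prime field.\<close>

definition mod_char :: "'p::prime_card mod_ring \<Rightarrow> complex" where
  "mod_char x = cis (2 * pi * of_int (to_int_mod_ring x) / CARD('p))"

lemma mod_char_0 [simp]: "mod_char 0 = 1"
  by (simp add: mod_char_def)

lemma norm_mod_char [simp]: "norm (mod_char x) = 1"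
  by (simp add: mod_char_def)

lemma mod_char_add: "mod_char (x + y) = mod_char x * mod_char (y :: 'p::prime_card mod_ring)"
proof -
  let ?p = "int CARD('p)" and ?s = "to_int_mod_ring x + to_int_mod_ring y"
  have "real_of_int ?s = of_int (?s mod ?p) + of_int ?p * of_int (?s div ?p)"
    by (metis mod_mult_div_eq of_int_add of_int_mult)
  then have "2 * pi * of_int ?s / CARD('p)
      = 2 * pi * of_int (?s mod ?p) / CARD('p) + 2 * pi * of_int (?s div ?p)"
    by (simp add: field_simps)
  then have "cis (2 * pi * of_int ?s / CARD('p)) = cis (2 * pi * of_int (?s mod ?p) / CARD('p))"
    by (simp flip: cis_mult)
  then show ?thesis
    by (simp add: mod_char_def to_int_mod_ring_add cis_mult add_divide_distrib distrib_left)
qed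

lemma mod_char_minus: "mod_char (- x) = cnj (mod_char x)"
proof -
  have "mod_char (- x) * mod_char x = 1"
    by (simp flip: mod_char_add)
  moreover have "cnj (mod_char x) * mod_char x = 1"
    by (simp add: mod_char_def cis_cnj cis_mult)
  moreover have "mod_char x \<noteq> 0"
    by (simp add: mod_char_def)
  ultimately show ?thesis
    by (metis mult_right_cancel)
qed

lemma mod_char_diff: "mod_char (x - y) = mod_char x * cnj (mod_char y)"
  using mod_char_add [of x "- y"] by (simp add: mod_char_minus)

lemma mod_char_1_neq_1: "mod_char (1 :: 'p::prime_card mod_ring) \<noteq> 1"
proof
  have p: "CARD('p) > 1" by (rule nontriv)
  assume "mod_char (1 :: 'p mod_ring) = 1"
  then have "cos (2 * pi / CARD('p)) = 1"
    by (simp add: mod_char_def complex_eq_iff)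
  then obtain n :: int where "2 * pi / CARD('p) = of_int n * 2 * pi"
    using cos_one_2pi_int by blast
  then have "real_of_int (n * int CARD('p)) = 1"
    using p by (simp add: field_simps)
  then have "n * int CARD('p) = 1"
    by linarith
  then show False
    using p by (simp add: zmult_eq_1_iff)
qed

text \<open>Translation by a vector \<open>w\<close> with \<open>l \<cdot> w = 1\<close> permutes
  the summation range but multiplies the sum by \<open>mod_char 1\<close>, which is not 1.\<close>

lemma sum_mod_char:
  fixes l :: "'p::prime_card mod_ring ^ 'n"
  shows "(\<Sum>x\<in>UNIV. mod_char (l \<cdot> x)) = (if l = 0 then of_nat CARD('p mod_ring ^ 'n) else 0)"
proof (cases "l = 0")
  case False
  then obtain i where i: "l $ i \<noteq> 0"
    by (auto simp: vec_eq_iff)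
  define w :: "'p mod_ring ^ 'n" where "w = axis i (inverse (l $ i))"
  have lw: "l \<cdot> w = 1"
    using i by (simp add: w_def scalar_product_axis)
  have "(\<Sum>x\<in>UNIV. mod_char (l \<cdot> x)) = (\<Sum>x\<in>UNIV. mod_char (l \<cdot> (x + w)))"
    by (rule sum.reindex_bij_witness [of _ "\<lambda>x. x + w" "\<lambda>x. x - w"]) auto
  also have "\<dots> = (\<Sum>x\<in>UNIV. mod_char (l \<cdot> x)) * mod_char (1 :: 'p mod_ring)"
    by (simp add: scalar_product_add_right lw mod_char_add sum_distrib_right)
  finally show ?thesis
    using False mod_char_1_neq_1 [where 'p = 'p] by simp
qed simp

text \<open>Weyl differencing: in |S|^2 put x = h + y. The phase becomes linear in y with
  coefficient 2Ah, so orthogonality leaves only h = 0.\<close>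

lemma norm_gauss_sum:
  fixes A :: "'p::prime_card mod_ring ^ 'n ^ 'n"
  assumes sym: "transpose A = A" and inj: "inj ((*v) A)" and odd: "(2 :: 'p mod_ring) \<noteq> 0"
  shows "(norm (\<Sum>z\<in>UNIV. mod_char (z \<cdot> (A *v z) + l \<cdot> z)))\<^sup>2 = real CARD('p mod_ring ^ 'n)"
proof -
  define f where "f z = z \<cdot> (A *v z) + l \<cdot> z" for z
  have f_add: "f (h + y) - f y = f h + (A *v h + A *v h) \<cdot> y" for h y
  proof -
    have "(A *v h + A *v h) \<cdot> y = y \<cdot> (A *v h) + y \<cdot> (A *v h)"
      by (simp only: scalar_product_add_left scalar_product_commute [of "A *v h" y])
    then show ?thesis
      by (simp only:) (simp add: f_def scalar_product_add_left scalar_product_add_right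
          matrix_vector_right_distrib scalar_product_symmetric_matrix [OF sym, of h y])
  qed
  have zero: "A *v h + A *v h = 0 \<longleftrightarrow> h = 0" for h
  proof
    assume "A *v h + A *v h = 0"
    then have "(A *v h) $ i = 0" for i
      using odd by (metis mult_2 mult_eq_0_iff vector_add_component zero_index)
    then have "A *v h = A *v 0"
      by (simp add: vec_eq_iff)
    then show "h = 0"
      using inj by (meson injD)
  qed simp
  let ?S = "\<Sum>z\<in>UNIV. mod_char (f z)"
  have "complex_of_real ((norm ?S)\<^sup>2) = ?S * cnj ?S"
    by (rule complex_norm_square)
  also have "\<dots> = (\<Sum>y\<in>UNIV. \<Sum>x\<in>UNIV. mod_char (f x - f y))"
    by (subst sum.swap) (simp add: cnj_sum sum_product mod_char_diff)
  also have "\<dots> = (\<Sum>y\<in>UNIV. \<Sum>h\<in>UNIV. mod_char (f (h + y) - f y))"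
  proof (rule sum.cong [OF refl])
    fix y
    show "(\<Sum>x\<in>UNIV. mod_char (f x - f y)) = (\<Sum>h\<in>UNIV. mod_char (f (h + y) - f y))"
      by (rule sum.reindex_bij_witness [of _ "\<lambda>h. h + y" "\<lambda>x. x - y"]) auto
  qed
  also have "\<dots> = (\<Sum>h\<in>UNIV. mod_char (f h) * (\<Sum>y\<in>UNIV. mod_char ((A *v h + A *v h) \<cdot> y)))"
    by (subst sum.swap) (simp only: f_add mod_char_add sum_distrib_left)
  also have "\<dots> = (\<Sum>h\<in>(UNIV :: ('p mod_ring ^ 'n) set). if h = 0 then of_nat CARD('p mod_ring ^ 'n) else 0)"
    by (rule sum.cong [OF refl], simp only: sum_mod_char zero) (simp add: f_def)
  finally have "complex_of_real ((norm ?S)\<^sup>2) = of_real (real CARD('p mod_ring ^ 'n))"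
    by simp
  then show ?thesis
    unfolding f_def by (simp only: of_real_eq_iff)
qed

text \<open>Summing \<open>T\<close> over all dual variables gives K^3 times the number of
  solutions. By \<open>indep\<close> the part \<kappa> = 0 is exactly V, while every other
  \<open>T\<close> has norm sqrt V; as K^3 \<le> sqrt V, these cannot cancel V.\<close>

lemma exists_bil_eq:
  fixes M :: "'k::finite \<Rightarrow> 'p::prime_card mod_ring ^ 'n ^ 'n"
  assumes sym: "\<And>i. transpose (M i) = M i"
    and inj: "\<And>\<kappa>. \<kappa> \<noteq> 0 \<Longrightarrow> inj ((*v) (pencil M \<kappa>))"
    and odd: "(2 :: 'p mod_ring) \<noteq> 0"
    and indep: "\<And>\<mu> \<nu>. pencil M \<mu> *v a + pencil M \<nu> *v b = 0 \<Longrightarrow> \<mu> = 0 \<and> \<nu> = 0"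
    and dim: "6 * CARD('k) \<le> CARD('n)"
  shows "\<exists>z. bil M z z = q \<and> bil M z a = u \<and> bil M z b = v"
proof (rule ccontr)
  assume none: "\<nexists>z. bil M z z = q \<and> bil M z a = u \<and> bil M z b = v"
  define V where "V = real CARD('p mod_ring ^ 'n)"
  define K where "K = real CARD('p mod_ring ^ 'k)"
  define c where "c \<kappa> \<mu> \<nu> = \<kappa> \<cdot> q + \<mu> \<cdot> u + \<nu> \<cdot> v" for \<kappa> \<mu> \<nu>
  define G where "G \<kappa> \<mu> \<nu> z =
    \<kappa> \<cdot> (bil M z z - q) + \<mu> \<cdot> (bil M z a - u) + \<nu> \<cdot> (bil M z b - v)" for \<kappa> \<mu> \<nu> z
  define T where "T \<kappa> \<mu> \<nu> = (\<Sum>z\<in>UNIV. mod_char (G \<kappa> \<mu> \<nu> z))" for \<kappa> \<mu> \<nu>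
  define F where "F \<kappa> = (\<Sum>\<mu>\<in>UNIV. \<Sum>\<nu>\<in>UNIV. T \<kappa> \<mu> \<nu>)" for \<kappa>
  have G: "G \<kappa> \<mu> \<nu> z = z \<cdot> (pencil M \<kappa> *v z) + (pencil M \<mu> *v a + pencil M \<nu> *v b) \<cdot> z - c \<kappa> \<mu> \<nu>"
    for \<kappa> \<mu> \<nu> z
    by (simp add: G_def c_def scalar_product_commute [of "_ + _" z] scalar_product_add_right
        scalar_product_diff_right scalar_product_pencil)
  have T: "T \<kappa> \<mu> \<nu> = (\<Sum>z\<in>UNIV. mod_char (z \<cdot> (pencil M \<kappa> *v z)
      + (pencil M \<mu> *v a + pencil M \<nu> *v b) \<cdot> z)) * cnj (mod_char (c \<kappa> \<mu> \<nu>))" for \<kappa> \<mu> \<nu>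
    by (simp add: T_def G mod_char_diff sum_distrib_right)
  have normT: "norm (T \<kappa> \<mu> \<nu>) = sqrt V" if "\<kappa> \<noteq> 0" for \<kappa> \<mu> \<nu>
    using norm_gauss_sum [OF transpose_pencil inj odd, OF sym that]
    by (simp add: T norm_mult V_def real_sqrt_unique [symmetric])
  have "(\<Sum>\<kappa>\<in>UNIV. F \<kappa>) = (\<Sum>\<kappa>\<in>UNIV. \<Sum>\<mu>\<in>UNIV. \<Sum>z\<in>UNIV. \<Sum>\<nu>\<in>UNIV. mod_char (G \<kappa> \<mu> \<nu> z))"
    unfolding F_def T_def
    by (rule sum.cong [OF refl], rule sum.cong [OF refl], rule sum.swap)
  also have "\<dots> = (\<Sum>\<kappa>\<in>UNIV. \<Sum>z\<in>UNIV. \<Sum>\<mu>\<in>UNIV. \<Sum>\<nu>\<in>UNIV. mod_char (G \<kappa> \<mu> \<nu> z))"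
    by (rule sum.cong [OF refl], rule sum.swap)
  also have "\<dots> = (\<Sum>z\<in>UNIV. \<Sum>\<kappa>\<in>UNIV. \<Sum>\<mu>\<in>UNIV. \<Sum>\<nu>\<in>UNIV. mod_char (G \<kappa> \<mu> \<nu> z))"
    by (rule sum.swap)
  \<comment> \<open>For fixed z the phase is additive in the dual variables, so the triple sum
    factors. Each factor detects one equation, and without a solution some factor vanishes.\<close>
  also have "\<dots> = (\<Sum>z\<in>UNIV. (\<Sum>\<kappa>\<in>UNIV. mod_char ((bil M z z - q) \<cdot> \<kappa>))
      * ((\<Sum>\<mu>\<in>UNIV. mod_char ((bil M z a - u) \<cdot> \<mu>))
      * (\<Sum>\<nu>\<in>UNIV. mod_char ((bil M z b - v) \<cdot> \<nu>))))"
    by (simp only: G_def mod_char_add mult.assoc scalar_product_commute [of _ "bil M _ _ - _"]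
        flip: sum_distrib_left sum_distrib_right)
  also have "\<dots> = 0"
    by (rule sum.neutral) (use none in \<open>auto simp: sum_mod_char\<close>)
  finally have total: "(\<Sum>\<kappa>\<in>UNIV. F \<kappa>) = 0" .
  have T0: "T 0 \<mu> \<nu> = (if \<mu> = 0 \<and> \<nu> = 0 then of_real V else 0)" for \<mu> \<nu>
    using indep [of \<mu> \<nu>] by (auto simp: T sum_mod_char V_def c_def)
  have F0: "F 0 = of_real V"
  proof -
    have "F 0 = (\<Sum>\<mu>\<in>(UNIV :: ('p mod_ring ^ 'k) set). if \<mu> = 0 then of_real V else 0)"
      unfolding F_def T0 by (intro sum.cong refl) auto
    then show ?thesis by simp
  qed
  have normF: "norm (F \<kappa>) \<le> K * (K * sqrt V)" if "\<kappa> \<noteq> 0" for \<kappa>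
  proof -
    have "norm (F \<kappa>) \<le> (\<Sum>\<mu>\<in>(UNIV :: ('p mod_ring ^ 'k) set). \<Sum>\<nu>\<in>(UNIV :: ('p mod_ring ^ 'k) set). sqrt V)"
      unfolding F_def by (intro sum_norm_le) (simp add: normT [OF that])
    then show ?thesis by (simp add: K_def)
  qed
  have "F 0 = - (\<Sum>\<kappa>\<in>UNIV - {0}. F \<kappa>)"
    using total by (simp add: sum.remove [of UNIV 0] eq_neg_iff_add_eq_0)
  then have "norm (F 0) \<le> (\<Sum>\<kappa>\<in>UNIV - {0 :: 'p mod_ring ^ 'k}. K * (K * sqrt V))"
    by (simp only: norm_minus_cancel) (intro sum_norm_le normF, simp)
  \<comment> \<open>Only nonzero \<kappa> are counted, hence K - 1. This gives the strictness needed
    at the end, where only K^3 \<le> sqrt V is available.\<close>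
  then have "V \<le> (K - 1) * (K * (K * sqrt V))"
  proof -
    have "norm (F 0) = V"
      by (simp add: F0) (simp add: V_def)
    moreover have "real (card (UNIV - {0 :: 'p mod_ring ^ 'k})) = K - 1"
      by (simp add: K_def card_Diff_singleton of_nat_diff)
    ultimately show ?thesis
      using \<open>norm (F 0) \<le> _\<close> by simp
  qed
  then have "sqrt V * sqrt V \<le> (K - 1) * (K * K) * sqrt V"
    by (simp add: V_def mult_ac)
  moreover have "sqrt V > 0"
    by (simp add: V_def)
  ultimately have upper: "sqrt V \<le> (K - 1) * (K * K)"
    by (simp only: mult_le_cancel_right)
  have K1: "K \<ge> 1"
    unfolding K_def by (simp add: Suc_leI)
  have "K ^ 3 \<le> sqrt V"
  proof (rule real_le_rsqrt)
    have "(K ^ 3)\<^sup>2 = real CARD('p) ^ (6 * CARD('k))"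
      by (simp add: K_def power_mult [symmetric] mult.commute)
    also have "\<dots> \<le> V"
      using dim nontriv [where 'a = 'p] by (simp add: V_def power_increasing)
    finally show "(K ^ 3)\<^sup>2 \<le> V" .
  qed
  moreover have "K * K > 0"
    using K1 by simp
  ultimately show False
    using upper
    by (simp add: power3_eq_cube algebra_simps)
qed

section \<open>The parallelogram\<close>

text \<open>Subtracting a point of a nonempty fibre of the functional maps that fibre injectively
  into the kernel.\<close>

lemma card_orthogonal:
  fixes w :: "'a::{finite, comm_ring_1} ^ 'n"
  shows "CARD('a ^ 'n) \<le> CARD('a) * card {x. w \<cdot> x = 0}"
proof -
  have "card {x. w \<cdot> x = c} \<le> card {x. w \<cdot> x = 0}" for c
  proof (cases "\<exists>y. w \<cdot> y = c")
    case True
    then obtain y where "w \<cdot> y = c" ..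
    then show ?thesis
      by (intro card_inj_on_le [of "\<lambda>x. x - y"])
        (auto simp: inj_on_def scalar_product_diff_right)
  qed (simp add: not_ex)
  moreover have "CARD('a ^ 'n) = card (\<Union>c. {x. w \<cdot> x = c})"
    by (rule arg_cong [where f = card]) auto
  moreover have "card (\<Union>c. {x. w \<cdot> x = c}) \<le> (\<Sum>c\<in>UNIV. card {x. w \<cdot> x = c})"
    by (rule card_UN_le) simp
  moreover have "(\<Sum>c\<in>UNIV. card {x. w \<cdot> x = c}) \<le> (\<Sum>c\<in>(UNIV :: 'a set). card {x. w \<cdot> x = 0})"
    by (intro sum_mono) (rule calculation(1))
  ultimately show ?thesis by simp
qed

text \<open>A bad b is determined by any relation (\<mu>, \<nu>) it satisfies: \<nu> \<noteq> 0,
  since otherwise a = 0, and so \<open>pencil M \<nu>\<close> is injective. With k =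
  \<open>CARD('k)\<close>, at most p^(2k) vectors are bad, but at least p^(n-1) are orthogonal to
  w.\<close>

lemma exists_independent_orthogonal:
  fixes M :: "'k::finite \<Rightarrow> 'p::prime_card mod_ring ^ 'n ^ 'n"
  assumes inj: "\<And>\<kappa>. \<kappa> \<noteq> 0 \<Longrightarrow> inj ((*v) (pencil M \<kappa>))"
    and a: "a \<noteq> 0" and dim: "2 * CARD('k) + 1 < CARD('n)"
  obtains b where "w \<cdot> b = 0"
    and "\<And>\<mu> \<nu>. pencil M \<mu> *v a + pencil M \<nu> *v b = 0 \<Longrightarrow> \<mu> = 0 \<and> \<nu> = 0"
proof -
  let ?R = "\<lambda>b \<mu> \<nu>. pencil M \<mu> *v a + pencil M \<nu> *v b = 0 \<and> \<not> (\<mu> = 0 \<and> \<nu> = 0)"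
  define Bad where "Bad = {b. \<exists>\<mu> \<nu>. ?R b \<mu> \<nu>}"
  have "\<forall>b\<in>Bad. \<exists>t. ?R b (fst t) (snd t)"
    unfolding Bad_def by auto
  then obtain t where t: "\<And>b. b \<in> Bad \<Longrightarrow> ?R b (fst (t b)) (snd (t b))"
    by metis
  have "inj_on t Bad"
  proof (rule inj_onI)
    fix b b' assume b: "b \<in> Bad" "b' \<in> Bad" "t b = t b'"
    have "snd (t b) \<noteq> 0"
    proof
      assume 0: "snd (t b) = 0"
      then have "fst (t b) \<noteq> 0" "pencil M (fst (t b)) *v a = pencil M (fst (t b)) *v 0"
        using t [OF b(1)] by auto
      then show False
        using inj a by (meson injD)
    qed
    moreover have "pencil M (snd (t b)) *v b = pencil M (snd (t b)) *v b'"
      using t [OF b(1)] t [OF b(2)] b(3) by (metis add_left_cancel)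
    ultimately show "b = b'"
      using inj by (meson injD)
  qed
  then have "card Bad \<le> CARD(('p mod_ring ^ 'k) \<times> ('p mod_ring ^ 'k))"
    by (intro card_inj_on_le) auto
  then have "CARD('p) * card Bad \<le> CARD('p) ^ (2 * CARD('k) + 1)"
    by (simp add: mult_2 power_add)
  also have "\<dots> < CARD('p) ^ CARD('n)"
    using dim nontriv [where 'a = 'p] by (intro power_strict_increasing) auto
  also have "\<dots> \<le> CARD('p) * card {x. w \<cdot> x = 0}"
    using card_orthogonal [of w] by simp
  finally have "card Bad < card {x. w \<cdot> x = 0}"
    by simp
  then have "\<not> {x. w \<cdot> x = 0} \<subseteq> Bad"
    by (meson card_mono finite linorder_not_le)
  then obtain b where "w \<cdot> b = 0" "b \<notin> Bad"
    by auto
  then show thesis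
    using that unfolding Bad_def by blast
qed

text \<open>Cases in which the values of the first two forms at a point settle whether it lies in
  \<open>QGS M\<close>.\<close>

definition decided :: "'a::field ^ 2 \<Rightarrow> bool \<Rightarrow> bool" where
  "decided v s \<longleftrightarrow> (if s then v $ 1 = 1 \<or> v $ 1 = 0 \<and> v $ 2 = 1
     else v $ 1 \<noteq> 1 \<and> (v $ 1 = 0 \<longrightarrow> v $ 2 \<noteq> 0 \<and> v $ 2 \<noteq> 1))"

text \<open>The last argument is the value forced at the fourth vertex. As c has first coordinate 0,
  first coordinates are chosen independently of c; \<open>c $ 2\<close> matters only where the
  fourth first coordinate can be 0.\<close>

lemma exists_decided:
  fixes c :: "'a::field ^ 2"
  assumes odd: "(2 :: 'a) \<noteq> 0" and c: "c $ 1 = 0"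
  shows "\<exists>\<alpha> \<beta> \<gamma>. decided \<alpha> s \<and> decided \<beta> t \<and> decided \<gamma> r \<and> decided (\<beta> + \<gamma> - \<alpha> + c) w"
proof -
  define V where "V x y = (vector [x, y] :: 'a ^ 2)" for x y
  have V [simp]: "V x y $ 1 = x" "V x y $ 2 = y" for x y
    by (simp_all add: V_def)
  have ne [simp]: "(2 :: 'a) \<noteq> 0" "(2 :: 'a) \<noteq> 1" "(-1 :: 'a) \<noteq> 1" "(-3 :: 'a) \<noteq> 1"
  proof -
    show "(2 :: 'a) \<noteq> 0" by (fact odd)
    show "(2 :: 'a) \<noteq> 1" by (metis add_cancel_right_right one_add_one one_neq_zero)
    show "(-1 :: 'a) \<noteq> 1" using odd by (metis add.right_inverse one_add_one)
    have "(2 :: 'a) * 2 \<noteq> 0" using odd by (metis mult_eq_0_iff)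
    moreover have "(2 :: 'a) * 2 = 1 + 3" by simp
    ultimately show "(-3 :: 'a) \<noteq> 1" by (metis add.commute add.right_inverse)
  qed
  note D = decided_def c
  \<comment> \<open>The first coordinates \<open>-3\<close> below vanish for \<open>p = 3\<close>, so there the second ones are \<open>-1\<close>.\<close>
  consider "s \<and> t \<and> r \<and> w" | "\<not> s \<and> \<not> t \<and> \<not> r \<and> \<not> w"
    | "s \<and> \<not> t \<and> \<not> r \<and> \<not> w" | "\<not> s \<and> t \<and> \<not> r \<and> \<not> w"
    | "\<not> s \<and> \<not> t \<and> r \<and> \<not> w" | "\<not> s \<and> \<not> t \<and> \<not> r \<and> w"
    | "s \<and> t \<and> \<not> r \<and> \<not> w" | "s \<and> \<not> t \<and> r \<and> \<not> w"
    | "\<not> s \<and> \<not> t \<and> r \<and> w" | "\<not> s \<and> t \<and> \<not> r \<and> w"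
    | "s \<and> \<not> t \<and> \<not> r \<and> w" | "\<not> s \<and> t \<and> r \<and> \<not> w"
    | "s \<and> t \<and> r \<and> \<not> w" | "\<not> s \<and> t \<and> r \<and> w"
    | "s \<and> t \<and> \<not> r \<and> w" | "s \<and> \<not> t \<and> r \<and> w"
    by (cases s; cases t; cases r; cases w) simp_all
  then show ?thesis
  proof cases
    case 1
    then show ?thesis
      by (intro exI [of _ "V 1 0"] exI [of _ "V 1 0"] exI [of _ "V 1 0"]) (simp add: D)
  next
    case 2
    then show ?thesis
      by (intro exI [of _ "V (-1) 0"] exI [of _ "V (-1) 0"] exI [of _ "V (-1) 0"]) (simp add: D)
  next
    \<comment> \<open>The fourth value is (-3, -1): \<open>c $ 2\<close> is cancelled because the
      second coordinate decides when p = 3.\<close>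
    case 3
    then show ?thesis
      by (intro exI [of _ "V 1 0"] exI [of _ "V (-1) (- 1 - c $ 2)"] exI [of _ "V (-1) 0"]) (simp add: D)
  next
    case 4
    then show ?thesis
      by (intro exI [of _ "V (-1) 0"] exI [of _ "V 1 0"] exI [of _ "V (-3) (-1)"]) (simp add: D)
  next
    case 5
    then show ?thesis
      by (intro exI [of _ "V (-1) 0"] exI [of _ "V (-3) (-1)"] exI [of _ "V 1 0"]) (simp add: D)
  next
    case 6
    then show ?thesis
      by (intro exI [of _ "V (-3) (-1)"] exI [of _ "V (-1) 0"] exI [of _ "V (-1) 0"]) (simp add: D)
  next
    case 7
    then show ?thesis
      by (intro exI [of _ "V 1 0"] exI [of _ "V 1 0"] exI [of _ "V (-1) 0"]) (simp add: D)
  next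
    case 8
    then show ?thesis
      by (intro exI [of _ "V 1 0"] exI [of _ "V (-1) 0"] exI [of _ "V 1 0"]) (simp add: D)
  next
    case 9
    then show ?thesis
      by (intro exI [of _ "V (-1) 0"] exI [of _ "V (-1) 0"] exI [of _ "V 1 0"]) (simp add: D)
  next
    case 10
    then show ?thesis
      by (intro exI [of _ "V (-1) 0"] exI [of _ "V 1 0"] exI [of _ "V (-1) 0"]) (simp add: D)
  next
    case 11
    then show ?thesis
      by (intro exI [of _ "V 1 0"] exI [of _ "V 0 (-1)"] exI [of _ "V 2 0"]) (simp add: D)
  next
    case 12
    then show ?thesis
      by (intro exI [of _ "V 0 (-1)"] exI [of _ "V 1 0"] exI [of _ "V 1 0"]) (simp add: D)
  next
    \<comment> \<open>From here on exactly three vertices belong. If all three had first coordinate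
      1, so would the fourth; hence some members take the value (0, 1).\<close>
    case 13
    then show ?thesis
      by (intro exI [of _ "V 1 0"] exI [of _ "V 0 1"] exI [of _ "V 0 1"]) (simp add: D)
  next
    case 14
    then show ?thesis
      by (intro exI [of _ "V (-1) 0"] exI [of _ "V 0 1"] exI [of _ "V 0 1"]) (simp add: D)
  next
    case 15
    then show ?thesis
      by (intro exI [of _ "V 0 1"] exI [of _ "V 1 0"] exI [of _ "V (-1) (2 - c $ 2)"]) (simp add: D)
  next
    case 16
    then show ?thesis
      by (intro exI [of _ "V 0 1"] exI [of _ "V (-1) (2 - c $ 2)"] exI [of _ "V 1 0"]) (simp add: D)
  qed
qed

section \<open>Shattering a two by two grid\<close>

theorem theorem4p3:
  fixes M :: "nat \<Rightarrow> 'p::prime_card mod_ring ^ 'n ^ 'n"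
  assumes "CARD('p) > 2"
    and "CARD('n) \<ge> 13"
    and "\<And>i. i \<in> {1..CARD('n)} \<Longrightarrow> transpose (M i) = M i"
    and "\<And>c :: nat \<Rightarrow> 'p mod_ring. \<exists>i \<in> {1..CARD('n)}. c i \<noteq> 0 \<Longrightarrow>
           rank (mat_lincomb c M) = CARD('n)"
  shows "vc2_dim (QGS M) \<ge> 2"
proof -
  let ?n = "CARD('n)"
  \<comment> \<open>In the index type \<open>2\<close> the numeral 2 equals 0; the
    \<open>else\<close> branch covers it.\<close>
  define N :: "2 \<Rightarrow> 'p mod_ring ^ 'n ^ 'n" where "N i = (if i = 1 then M 1 else M 2)" for i
  have sym: "transpose (N i) = N i" for i
    using assms(2,3) by (simp add: N_def)
  have inj: "inj ((*v) (pencil N \<kappa>))" if "\<kappa> \<noteq> 0" for \<kappa>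
  proof -
    define c where "c i = (if i = 1 then \<kappa> $ 1 else if i = 2 then \<kappa> $ 2 else 0)" for i :: nat
    have "(\<Sum>i = 1..?n. c i * M i $ r $ s) = (\<Sum>i\<in>{1, 2}. c i * M i $ r $ s)" for r s
      using assms(2) by (intro sum.mono_neutral_right) (auto simp: c_def)
    then have "mat_lincomb c M = pencil N \<kappa>"
      by (simp add: mat_lincomb_def pencil_def sum_2 N_def c_def)
    moreover have "c 1 \<noteq> 0 \<or> c 2 \<noteq> 0"
      using that by (auto simp: c_def vec_eq_iff forall_2)
    then have "\<exists>i\<in>{1..?n}. c i \<noteq> 0"
      using assms(2) by auto
    then have "rank (mat_lincomb c M) = ?n"
      by (rule assms(4))
    ultimately show ?thesis
      by (simp add: full_rank_imp_inj_field)
  qed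
  have odd: "(2 :: 'p mod_ring) \<noteq> 0"
    using assms(1) of_nat_0_mod_ring_dvd [of 2, where 'a = 'p]
    by (metis dvd_imp_le linorder_not_le of_nat_numeral zero_less_numeral)
  define a :: "'p mod_ring ^ 'n" where "a = axis undefined 1"
  have "a \<noteq> 0"
    by (simp add: a_def axis_eq_0_iff)
  \<comment> \<open>Orthogonality to \<open>N 1 *v a\<close> kills the cross term of the first form,
    as \<open>exists_decided\<close> requires.\<close>
  then obtain b where orth: "(N 1 *v a) \<cdot> b = 0"
    and indep: "\<And>\<mu> \<nu>. pencil N \<mu> *v a + pencil N \<nu> *v b = 0 \<Longrightarrow> \<mu> = 0 \<and> \<nu> = 0"
    using exists_independent_orthogonal [OF inj, of a "N 1 *v a"] assms(2) by auto
  \<comment> \<open>With Q(x) = \<open>bil N x x\<close>, this is Q(z+a+b) - Q(z+a) - Q(z+b) + Q(z)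
    for every z.\<close>
  define c where "c = bil N a b + bil N b a"
  have c1: "c $ 1 = 0"
    using orth scalar_product_symmetric_matrix [OF sym, of a 1 b]
    by (simp add: c_def bil_def scalar_product_commute [of b])
  have mem: "x \<in> QGS M \<longleftrightarrow> s" if dec: "decided (bil N x x) s" for x s
  proof -
    have bil: "bil N x x $ 1 = quad_form (M 1) x" "bil N x x $ 2 = quad_form (M 2) x"
      by (simp_all add: bil_def quad_form_def N_def)
    show ?thesis
    proof
      assume s
      then consider "quad_form (M 1) x = 1" | "quad_form (M 1) x = 0" "quad_form (M 2) x = 1"
        using dec by (auto simp: decided_def bil)
      then show "x \<in> QGS M"
      proof cases
        case 1
        then show ?thesis
          using assms(2) unfolding QGS_def by (intro CollectI bexI [of _ 1]) auto
      next
        case 2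
        moreover have "{1..<2} = {1 :: nat}" by auto
        ultimately show ?thesis
          using assms(2) unfolding QGS_def by (intro CollectI bexI [of _ 2]) auto
      qed
    next
      assume "x \<in> QGS M"
      then obtain i where i: "i \<ge> 1" "\<forall>j\<in>{1..<i}. quad_form (M j) x = 0" "quad_form (M i) x = 1"
        by (auto simp: QGS_def)
      \<comment> \<open>For i > 2 both forms vanish at x, which \<open>decided\<close> excludes for
        either truth value.\<close>
      consider "i = 1" | "i = 2" | "i > 2" using i(1) by linarith
      then show s
        using dec i(2,3) by cases (auto simp: decided_def bil split: if_splits)
    qed
  qed
  have "\<exists>z. (z \<in> QGS M \<longleftrightarrow> s) \<and> (a + z \<in> QGS M \<longleftrightarrow> t) \<and> (b + z \<in> QGS M \<longleftrightarrow> r)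
      \<and> (a + b + z \<in> QGS M \<longleftrightarrow> w)" for s t r w
  proof -
    obtain \<alpha> \<beta> \<gamma> where dec: "decided \<alpha> s" "decided \<beta> t" "decided \<gamma> r" "decided (\<beta> + \<gamma> - \<alpha> + c) w"
      using exists_decided [OF odd c1] by blast
    \<comment> \<open>Moving from z to z + x adds \<open>bil N x x\<close> and twice
      \<open>bil N z x\<close>, so prescribing the value at a neighbour means halving.\<close>
    define h where "h v = (\<chi> i. v $ i / 2)" for v :: "'p mod_ring ^ 2"
    have h: "h v + h v = v" for v
      using odd by (simp add: h_def vec_eq_iff flip: mult_2)
    have "\<exists>z. bil N z z = \<alpha> \<and> bil N z a = h (\<beta> - \<alpha> - bil N a a)
        \<and> bil N z b = h (\<gamma> - \<alpha> - bil N b b)"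
      by (rule exists_bil_eq [OF sym inj odd]) (use indep assms(2) in auto)
    then obtain z where z: "bil N z z = \<alpha>" "bil N z a = h (\<beta> - \<alpha> - bil N a a)"
      "bil N z b = h (\<gamma> - \<alpha> - bil N b b)"
      by blast
    have za: "bil N z a + bil N z a = \<beta> - \<alpha> - bil N a a"
      and zb: "bil N z b + bil N z b = \<gamma> - \<alpha> - bil N b b"
      by (simp_all add: z h)
    have expand: "bil N (x + z) (x + z) = bil N x x + (bil N z x + bil N z x) + \<alpha>" for x
      by (simp add: bil_add_left bil_add_right bil_commute [of N x z, OF sym] z(1))
    have "bil N (a + z) (a + z) = \<beta>" "bil N (b + z) (b + z) = \<gamma>"
      by (simp_all only: expand za zb) simp_all
    moreover have "bil N (a + b + z) (a + b + z) = bil N a a + bil N b b + c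
        + (bil N z a + bil N z a) + (bil N z b + bil N z b) + \<alpha>"
      by (simp add: expand [of "a + b"] c_def bil_add_left bil_add_right z(1)
          bil_commute [of N z a, OF sym] bil_commute [of N z b, OF sym])
    then have "bil N (a + b + z) (a + b + z) = \<beta> + \<gamma> - \<alpha> + c"
      by (simp add: za zb)
    ultimately show ?thesis
      using dec z(1) mem by metis
  qed
  then obtain z where z: "\<And>s t r w. (z s t r w \<in> QGS M \<longleftrightarrow> s) \<and> (a + z s t r w \<in> QGS M \<longleftrightarrow> t)
      \<and> (b + z s t r w \<in> QGS M \<longleftrightarrow> r) \<and> (a + b + z s t r w \<in> QGS M \<longleftrightarrow> w)"
    by metis
  have "vc2_dim_at_least (QGS M) 2"
    unfolding vc2_dim_at_least_def
  proof (intro exI allI impI ballI)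
    fix S :: "(nat \<times> nat) set" and i j :: nat
    assume "i \<in> {1..2}" "j \<in> {1..2}"
    then have "(i = 1 \<or> i = 2) \<and> (j = 1 \<or> j = 2)" by auto
    \<comment> \<open>The sums of {0, a} and {0, b} translate z to the four vertices; the shift is
      chosen by the membership pattern of S.\<close>
    then show "(if i = 1 then 0 else a) + (if j = 1 then 0 else b)
        + z ((1, 1) \<in> S) ((2, 1) \<in> S) ((1, 2) \<in> S) ((2, 2) \<in> S) \<in> QGS M \<longleftrightarrow> (i, j) \<in> S"
      using z by auto
  qed
  then show ?thesis
    by (simp add: le_vc2_dim_iff)
qed

end
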